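(* Let $P,Q$ be orthogonal projections in a Hilbert space $\mathcal{H}$, let $P',Q'$ be their restrictions to $\mathcal{H}'=N(P+Q-1)^\perp$ and let $V$ be Davis' symmetry on $\mathcal{H}'$. Then $T=PQ$ is S-decomposable if and only if $Q'VQ'$ is diagonalizable (equivalently, $P'VP'$ is diagonalizable). If $\{\xi_n\}$ is an orthonormal system of eigenvectors for $Q'VQ'$, then $\langle V\xi_n,\xi_k\rangle=0$ if $n\neq k$.
   Context: $N(\cdot)$ and $R(\cdot)$ denote nullspace and range. For orthogonal projections $P,Q$, $N(P+Q-1)=(R(P)\cap N(Q))\oplus(N(P)\cap R(Q))$; the subspace $\mathcal{H}'=N(P+Q-1)^\perp$ reduces $P$ and $Q$, and $P'=P|_{\mathcal{H}'}$, $Q'=Q|_{\mathcal{H}'}$ are regarded as operators acting in $\mathcal{H}'$. The self-adjoint operator $S'=P'+Q'-1$ has trivial kernel and dense range in $\mathcal{H}'$; if $S'=V|S'|$ is its polar decomposition, then $V$ is a self-adjoint unitary operator on $\mathcal{H}'$, called Davis' symmetry, and $VP'V=Q'$, $VQ'V=P'$. A bounded operator $T$ on $\mathcal{H}$ is called S-decomposable if it has a singular value (Schmidt) decomposition $T=\sum_{n\ge 1} s_n\langle\,\cdot\,,\xi_n\rangle\psi_n$, where $\{\xi_n: n\ge 1\}$ and $\{\psi_n: n\ge 1\}$ are orthonormal systems and $s_n>0$; equivalently, $T^*T$ is diagonalizable. A self-adjoint operator is diagonalizable if there is an orthonormal basis of the space consisting of its eigenvectors.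
   Formalization: In the last sentence the eigenvectors ξ_n of Q'VQ' are taken in R(Q') (equivalently, with nonzero eigenvalues); with null vectors allowed it fails: in C², Q onto e1, P onto (cos t, sin t), 0<t<π/2, gives <Ve1,e2> = sin t ≠ 0. *)

theory Defs
  imports "HOL-Analysis.Analysis"
begin

text \<open>Complex Hilbert spaces of arbitrary (possibly uncountable) dimension. The inner product is
  linear in the first and conjugate linear in the second argument.\<close>

class complex_hilbert_space = banach +
  fixes scaleC :: "complex \<Rightarrow> 'a \<Rightarrow> 'a" (infixr "*\<^sub>C" 75)
    and cinner :: "'a \<Rightarrow> 'a \<Rightarrow> complex"
  assumes scaleR_scaleC: "scaleR r x = complex_of_real r *\<^sub>C x"
    and scaleC_add_right: "c *\<^sub>C (x + y) = c *\<^sub>C x + c *\<^sub>C y"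
    and scaleC_add_left: "(c + d) *\<^sub>C x = c *\<^sub>C x + d *\<^sub>C x"
    and scaleC_scaleC: "c *\<^sub>C (d *\<^sub>C x) = (c * d) *\<^sub>C x"
    and cinner_commute: "cinner x y = cnj (cinner y x)"
    and cinner_add_left: "cinner (x + y) z = cinner x z + cinner y z"
    and cinner_scaleC_left: "cinner (c *\<^sub>C x) y = c * cinner x y"
    and cinner_self_nonneg: "cinner x x \<in> \<real>\<^sub>\<ge>\<^sub>0"
    and norm_eq_sqrt_cinner: "norm x = sqrt (Re (cinner x x))"

instantiation complex :: complex_hilbert_space
begin

definition scaleC_complex :: "complex \<Rightarrow> complex \<Rightarrow> complex"
  where "scaleC_complex c x = c * x"

definition cinner_complex :: "complex \<Rightarrow> complex \<Rightarrow> complex"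
  where "cinner_complex x y = x * cnj y"

instance
  by standard
    (auto simp: scaleC_complex_def cinner_complex_def scaleR_conv_of_real algebra_simps
      complex_nonneg_Reals_iff cmod_def power2_eq_square)

end

definition bounded_clinear :: "('a::complex_hilbert_space \<Rightarrow> 'a) \<Rightarrow> bool"
  where "bounded_clinear T \<longleftrightarrow> bounded_linear T \<and> (\<forall>c x. T (c *\<^sub>C x) = c *\<^sub>C T x)"

definition orthogonal_projection :: "('a::complex_hilbert_space \<Rightarrow> 'a) \<Rightarrow> bool"
  where "orthogonal_projection P \<longleftrightarrow>
    bounded_clinear P \<and> P \<circ> P = P \<and> (\<forall>x y. cinner (P x) y = cinner x (P y))"

definition orth_complement :: "'a::complex_hilbert_space set \<Rightarrow> 'a set"
  where "orth_complement M = {x. \<forall>y\<in>M. cinner x y = 0}"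

definition orthonormal_family :: "'i set \<Rightarrow> ('i \<Rightarrow> 'a::complex_hilbert_space) \<Rightarrow> bool"
  where "orthonormal_family I \<xi> \<longleftrightarrow>
    (\<forall>i\<in>I. \<forall>j\<in>I. cinner (\<xi> i) (\<xi> j) = (if i = j then 1 else 0))"

text \<open>An orthonormal basis of a closed subspace \<open>M\<close> is a maximal orthonormal subset of \<open>M\<close>.\<close>

definition orthonormal_basis_of :: "'a::complex_hilbert_space set \<Rightarrow> 'a set \<Rightarrow> bool"
  where "orthonormal_basis_of M B \<longleftrightarrow>
    B \<subseteq> M \<and> orthonormal_family B (\<lambda>b. b) \<and>
    (\<forall>x\<in>M. (\<forall>b\<in>B. cinner x b = 0) \<longrightarrow> x = 0)"

text \<open>Operators acting in a closed subspace \<open>M\<close> are functions on the whole type of which only the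
  values on \<open>M\<close> matter; every notion with an argument \<open>M\<close> below ignores the values outside \<open>M\<close>.\<close>

definition bounded_operator_on ::
    "'a::complex_hilbert_space set \<Rightarrow> ('a \<Rightarrow> 'a) \<Rightarrow> bool"
  where "bounded_operator_on M A \<longleftrightarrow>
    (\<forall>x\<in>M. A x \<in> M) \<and>
    (\<forall>x\<in>M. \<forall>y\<in>M. A (x + y) = A x + A y) \<and>
    (\<forall>c. \<forall>x\<in>M. A (c *\<^sub>C x) = c *\<^sub>C A x) \<and>
    (\<exists>K. \<forall>x\<in>M. norm (A x) \<le> K * norm x)"

definition positive_operator_on ::
    "'a::complex_hilbert_space set \<Rightarrow> ('a \<Rightarrow> 'a) \<Rightarrow> bool"
  where "positive_operator_on M A \<longleftrightarrow>
    bounded_operator_on M A \<and> (\<forall>x\<in>M. cinner (A x) x \<in> \<real>\<^sub>\<ge>\<^sub>0)"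

text \<open>\<open>A = |S|\<close> on \<open>M\<close>: \<open>A\<close> is the positive square root of \<open>S\<^sup>* S\<close>. The equation \<open>A\<^sup>2 = S\<^sup>* S\<close> is
  tested against all \<open>y \<in> M\<close>, which avoids naming the adjoint.\<close>

definition modulus_on ::
    "'a::complex_hilbert_space set \<Rightarrow> ('a \<Rightarrow> 'a) \<Rightarrow> ('a \<Rightarrow> 'a) \<Rightarrow> bool"
  where "modulus_on M S A \<longleftrightarrow>
    positive_operator_on M A \<and>
    (\<forall>x\<in>M. \<forall>y\<in>M. cinner (A (A x)) y = cinner (S x) (S y))"

text \<open>\<open>S = V |S|\<close> on \<open>M\<close>, where \<open>V\<close> is a partial isometry with the same nullspace as \<open>S\<close>.\<close>

definition polar_decomposition_on ::
    "'a::complex_hilbert_space set \<Rightarrow> ('a \<Rightarrow> 'a) \<Rightarrow> ('a \<Rightarrow> 'a) \<Rightarrow> ('a \<Rightarrow> 'a) \<Rightarrow> bool"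
  where "polar_decomposition_on M S V A \<longleftrightarrow>
    modulus_on M S A \<and> bounded_operator_on M V \<and>
    (\<forall>x\<in>M. S x = V (A x)) \<and>
    (\<forall>x\<in>M. V x = 0 \<longleftrightarrow> S x = 0) \<and>
    (\<forall>x \<in> M \<inter> orth_complement {y\<in>M. S y = 0}. norm (V x) = norm x)"

definition davis_space ::
    "('a::complex_hilbert_space \<Rightarrow> 'a) \<Rightarrow> ('a \<Rightarrow> 'a) \<Rightarrow> 'a set"
  where "davis_space P Q = orth_complement {x. P x + Q x - x = 0}"

text \<open>The values of \<open>V\<close> on \<open>M\<close> are determined by \<open>P'\<close> and \<open>Q'\<close>, by uniqueness of the polar
  decomposition.\<close>

definition davis_symmetry ::
    "'a::complex_hilbert_space set \<Rightarrow> ('a \<Rightarrow> 'a) \<Rightarrow> ('a \<Rightarrow> 'a) \<Rightarrow> ('a \<Rightarrow> 'a) \<Rightarrow> bool"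
  where "davis_symmetry M P' Q' V \<longleftrightarrow>
    (\<exists>A. polar_decomposition_on M (\<lambda>x. P' x + Q' x - x) V A)"

text \<open>The singular values are indexed by a set \<open>I\<close> of arbitrary cardinality (finite, countable or
  not), as needed when the space is not separable; in a separable space \<open>I\<close> is automatically
  countable. Taking \<open>I\<close> inside the space itself loses nothing, because an orthonormal family is
  injective. The series converges pointwise.\<close>

definition S_decomposable :: "('a::complex_hilbert_space \<Rightarrow> 'a) \<Rightarrow> bool"
  where "S_decomposable T \<longleftrightarrow>
    bounded_clinear T \<and>
    (\<exists>(I :: 'a set) (s :: 'a \<Rightarrow> real) \<xi> \<psi>.
      orthonormal_family I \<xi> \<and> orthonormal_family I \<psi> \<and> (\<forall>i\<in>I. s i > 0) \<and>
      (\<forall>x. ((\<lambda>i. (complex_of_real (s i) * cinner x (\<xi> i)) *\<^sub>C \<psi> i) has_sum T x) I))"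

definition eigenvector_on ::
    "'a::complex_hilbert_space set \<Rightarrow> ('a \<Rightarrow> 'a) \<Rightarrow> 'a \<Rightarrow> bool"
  where "eigenvector_on M A x \<longleftrightarrow> x \<in> M \<and> x \<noteq> 0 \<and> (\<exists>c. A x = c *\<^sub>C x)"

definition self_adjoint_on ::
    "'a::complex_hilbert_space set \<Rightarrow> ('a \<Rightarrow> 'a) \<Rightarrow> bool"
  where "self_adjoint_on M A \<longleftrightarrow>
    bounded_operator_on M A \<and> (\<forall>x\<in>M. \<forall>y\<in>M. cinner (A x) y = cinner x (A y))"

definition diagonalizable_on ::
    "'a::complex_hilbert_space set \<Rightarrow> ('a \<Rightarrow> 'a) \<Rightarrow> bool"
  where "diagonalizable_on M A \<longleftrightarrow>
    self_adjoint_on M A \<and>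
    (\<exists>B. orthonormal_basis_of M B \<and> (\<forall>b\<in>B. eigenvector_on M A b))"

text \<open>An orthonormal system of eigenvectors of \<open>Q' V Q'\<close> is understood in the space \<open>R(Q')\<close>, in
  which \<open>Q' V Q'\<close> acts as the compression of \<open>V\<close>; equivalently, the eigenvalues are nonzero, since
  the nullspace of \<open>Q' V Q'\<close> in the whole domain of \<open>V\<close> is \<open>N(Q')\<close>. With eigenvectors from \<open>N(Q')\<close>
  allowed, the orthogonality of \<open>V \<xi>\<^sub>n\<close> and \<open>\<xi>\<^sub>k\<close> fails: in \<open>\<complex>\<^sup>2\<close>, let \<open>Q\<close> and \<open>P\<close> project onto the
  lines spanned by \<open>e\<^sub>1\<close> and \<open>(cos t, sin t)\<close> with \<open>0 < t < \<pi>/2\<close>; then \<open>V e\<^sub>1 = (cos t, sin t)\<close> and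
  \<open>e\<^sub>1, e\<^sub>2\<close> are eigenvectors of \<open>Q V Q\<close>, but the inner product of \<open>V e\<^sub>1\<close> and \<open>e\<^sub>2\<close> is \<open>sin t\<close>.\<close>

definition orthonormal_eigensystem_in_range ::
    "'i set \<Rightarrow> ('i \<Rightarrow> 'a::complex_hilbert_space) \<Rightarrow> 'a set \<Rightarrow> ('a \<Rightarrow> 'a) \<Rightarrow> ('a \<Rightarrow> 'a) \<Rightarrow> bool"
  where "orthonormal_eigensystem_in_range I \<xi> M Q' V \<longleftrightarrow>
    orthonormal_family I \<xi> \<and> (\<forall>i\<in>I. eigenvector_on (Q' ` M) (Q' \<circ> V \<circ> Q') (\<xi> i))"

end

theory Submission
  imports Defs
begin

text \<open>
  Write \<open>S = P + Q - 1\<close> and \<open>A = |S|\<close> on \<open>H'\<close>. Since \<open>S P = Q S\<close> and \<open>S Q = P S\<close>, the operator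
  \<open>S\<^sup>2 = A\<^sup>2\<close> commutes with \<open>P\<close> and \<open>Q\<close>, hence so does \<open>A\<close>. It follows that \<open>V\<close> is a self-adjoint
  involution with \<open>V P = Q V\<close>, so it carries eigenvectors of \<open>QVQ\<close> to eigenvectors of \<open>PVP\<close>. Moreover
  \<open>QVQ = A Q\<close> is the positive square root of \<open>QPQ = T\<^sup>* T\<close>. So an eigenbasis of \<open>QVQ\<close> provides the
  right singular vectors of \<open>T\<close>, and conversely the right singular vectors of \<open>T\<close> are eigenvectors
  of \<open>QVQ\<close>, which vanishes on their orthogonal complement. No functional calculus is used: that \<open>A\<close>
  commutes with \<open>P\<close> and \<open>Q\<close> comes from F. Riesz's elementary argument for products of commuting
  positive operators.
\<close>

section \<open>Complex inner product spaces\<close>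

interpretation complex_vector: vector_space "scaleC :: complex \<Rightarrow> 'a::complex_hilbert_space \<Rightarrow> 'a"
proof
  fix x :: 'a
  show "1 *\<^sub>C x = x"
    \<comment> \<open>The unit law is not an axiom of the class; it is inherited from real scalar
      multiplication.\<close>
    using scaleR_scaleC[of 1 x] by simp
qed (fact scaleC_add_right scaleC_add_left scaleC_scaleC)+

lemma cinner_add_right: "cinner x (y + z) = cinner x y + cinner x z"
  for x :: "'a::complex_hilbert_space"
  by (subst (1 2 3) cinner_commute) (simp add: cinner_add_left)

lemma cinner_scaleC_right: "cinner x (c *\<^sub>C y) = cnj c * cinner x y"
  for x :: "'a::complex_hilbert_space"
  by (subst (1 2) cinner_commute) (simp add: cinner_scaleC_left)

lemma cinner_zero_left [simp]: "cinner 0 x = 0" for x :: "'a::complex_hilbert_space"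
  using cinner_add_left[of 0 0 x] by simp

lemma cinner_zero_right [simp]: "cinner x 0 = 0" for x :: "'a::complex_hilbert_space"
  using cinner_add_right[of x 0 0] by simp

lemma cinner_minus_left: "cinner (- x) y = - cinner x y" for x :: "'a::complex_hilbert_space"
  using cinner_add_left[of x "- x" y] by (simp add: eq_neg_iff_add_eq_0 add.commute)

lemma cinner_minus_right: "cinner x (- y) = - cinner x y" for x :: "'a::complex_hilbert_space"
  using cinner_add_right[of x y "- y"] by (simp add: eq_neg_iff_add_eq_0 add.commute)

lemma cinner_diff_left: "cinner (x - y) z = cinner x z - cinner y z"
  for x :: "'a::complex_hilbert_space"
  using cinner_add_left[of x "- y" z] by (simp add: cinner_minus_left)

lemma cinner_diff_right: "cinner x (y - z) = cinner x y - cinner x z"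
  for x :: "'a::complex_hilbert_space"
  using cinner_add_right[of x y "- z"] by (simp add: cinner_minus_right)

lemmas cinner_linear =
  cinner_add_left cinner_add_right cinner_diff_left cinner_diff_right cinner_minus_left
  cinner_minus_right cinner_scaleC_left cinner_scaleC_right

lemma cinner_self: "cinner x x = complex_of_real ((norm x)\<^sup>2)"
  for x :: "'a::complex_hilbert_space"
  using cinner_self_nonneg[of x]
  by (simp add: complex_eq_iff complex_nonneg_Reals_iff norm_eq_sqrt_cinner)

lemma Re_cinner_commute: "Re (cinner x y) = Re (cinner y x)"
  for x :: "'a::complex_hilbert_space"
  by (subst cinner_commute) simp

lemma norm_add_sq: "(norm (x + y))\<^sup>2 = (norm x)\<^sup>2 + 2 * Re (cinner x y) + (norm y)\<^sup>2"
  for x :: "'a::complex_hilbert_space"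
proof -
  have "(norm (x + y))\<^sup>2 = Re (cinner (x + y) (x + y))"
    by (simp only: cinner_self Re_complex_of_real)
  also have "\<dots> = (norm x)\<^sup>2 + 2 * Re (cinner x y) + (norm y)\<^sup>2"
    unfolding cinner_add_left cinner_add_right by (simp add: cinner_self Re_cinner_commute[of y x])
  finally show ?thesis .
qed

lemma norm_scaleC: "norm (c *\<^sub>C x) = cmod c * norm x" for x :: "'a::complex_hilbert_space"
proof -
  have "complex_of_real ((norm (c *\<^sub>C x))\<^sup>2) = c * cnj c * complex_of_real ((norm x)\<^sup>2)"
    unfolding cinner_self[of "c *\<^sub>C x", symmetric]
    unfolding cinner_self[of x, symmetric]
    unfolding cinner_scaleC_left
    unfolding cinner_scaleC_right
    unfolding mult.assoc ..
  also have "\<dots> = complex_of_real ((cmod c * norm x)\<^sup>2)"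
    unfolding complex_norm_square[symmetric] by (simp add: power_mult_distrib)
  finally have "(norm (c *\<^sub>C x))\<^sup>2 = (cmod c * norm x)\<^sup>2"
    by (simp only: of_real_eq_iff)
  then show ?thesis
    by simp
qed

text \<open>The class already supplies the triangle inequality, so the usual order of deduction is
  reversed: squaring it and expanding leaves Cauchy-Schwarz for real parts.\<close>

lemma Re_cinner_le: "Re (cinner x y) \<le> norm x * norm y" for x :: "'a::complex_hilbert_space"
proof -
  have "(norm x)\<^sup>2 + 2 * Re (cinner x y) + (norm y)\<^sup>2 \<le> (norm x + norm y)\<^sup>2"
    unfolding norm_add_sq[symmetric] by (intro power_mono norm_triangle_ineq norm_ge_zero)
  then show ?thesis
    by (simp add: power2_sum)
qed

lemma norm_cinner_le: "cmod (cinner x y) \<le> norm x * norm y"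
  for x :: "'a::complex_hilbert_space"
proof (cases "cinner x y = 0")
  case False
  \<comment> \<open>A unimodular factor that rotates the inner product onto the positive real
    axis.\<close>
  let ?u = "cnj (cinner x y) / complex_of_real (cmod (cinner x y))"
  have "complex_of_real (cmod (cinner x y)) = cinner (?u *\<^sub>C x) y"
    using False by (simp add: cinner_linear field_simps complex_norm_square[symmetric] power2_eq_square)
  then have "cmod (cinner x y) = Re (cinner (?u *\<^sub>C x) y)"
    by (metis Re_complex_of_real)
  also have "\<dots> \<le> norm x * norm y"
    using Re_cinner_le[of "?u *\<^sub>C x" y] False by (simp add: norm_scaleC norm_divide)
  finally show ?thesis .
qed simp

lemma bounded_linear_cinner_left: "bounded_linear (\<lambda>x. cinner x y)"
  for y :: "'a::complex_hilbert_space"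
proof (rule bounded_linear_intro[where K = "norm y"])
  show "cinner (r *\<^sub>R x) y = r *\<^sub>R cinner x y" for r x
    unfolding scaleR_scaleC[of r x] cinner_scaleC_left scaleR_conv_of_real ..
qed (rule cinner_add_left norm_cinner_le)+

section \<open>Bounded operators on a subspace\<close>

lemma bounded_operator_on_simps:
  assumes "bounded_operator_on M A" "complex_vector.subspace M"
  shows "x \<in> M \<Longrightarrow> A x \<in> M"
    and "x \<in> M \<Longrightarrow> y \<in> M \<Longrightarrow> A (x + y) = A x + A y"
    and "x \<in> M \<Longrightarrow> A (c *\<^sub>C x) = c *\<^sub>C A x"
    and "x \<in> M \<Longrightarrow> y \<in> M \<Longrightarrow> A (x - y) = A x - A y"
    and "x \<in> M \<Longrightarrow> A (- x) = - A x"
    and "A 0 = 0"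
proof -
  have sc: "A (c *\<^sub>C x) = c *\<^sub>C A x" if "x \<in> M" for c x
    using assms that by (simp add: bounded_operator_on_def)
  then show "x \<in> M \<Longrightarrow> A (c *\<^sub>C x) = c *\<^sub>C A x" .
  show "A 0 = 0"
    using sc[of 0 0] assms(2) by (simp add: complex_vector.subspace_0)
  show neg: "A (- x) = - A x" if "x \<in> M" for x
    using sc[OF that, of "-1"] by simp
  show add: "A (x + y) = A x + A y" if "x \<in> M" "y \<in> M" for x y
    using assms that by (simp add: bounded_operator_on_def)
  show "A (x - y) = A x - A y" if "x \<in> M" "y \<in> M" for x y
    using add[of x "- y"] neg[of y] that assms(2) by (simp add: complex_vector.subspace_neg)
  show "x \<in> M \<Longrightarrow> A x \<in> M"
    using assms(1) by (simp add: bounded_operator_on_def)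
qed

lemma bounded_operator_on_bound:
  assumes "bounded_operator_on M A"
  obtains K where "K > 0" "\<And>x. x \<in> M \<Longrightarrow> norm (A x) \<le> K * norm x"
proof -
  obtain K where K: "\<forall>x\<in>M. norm (A x) \<le> K * norm x"
    using assms by (auto simp: bounded_operator_on_def)
  show thesis
  proof
    \<comment> \<open>The given bound may fail to be positive, and later a bound is used as a
      divisor.\<close>
    show "norm (A x) \<le> (\<bar>K\<bar> + 1) * norm x" if "x \<in> M" for x
      using K that by (smt (verit) mult_right_mono norm_ge_zero)
  qed simp
qed

lemma bounded_operator_on_compose:
  assumes "bounded_operator_on M A" "bounded_operator_on M B"
  shows "bounded_operator_on M (A \<circ> B)"
proof -
  obtain K L where K: "K > 0" "\<And>x. x \<in> M \<Longrightarrow> norm (A x) \<le> K * norm x"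
    and L: "L > 0" "\<And>x. x \<in> M \<Longrightarrow> norm (B x) \<le> L * norm x"
    using assms by (meson bounded_operator_on_bound)
  have "norm (A (B x)) \<le> (K * L) * norm x" if "x \<in> M" for x
  proof -
    have "norm (A (B x)) \<le> K * norm (B x)"
      using K(2) assms(2) that by (simp add: bounded_operator_on_def)
    also have "\<dots> \<le> K * (L * norm x)"
      using K(1) L(2) that by (simp add: mult_left_mono)
    finally show ?thesis by (simp add: mult.assoc)
  qed
  then show ?thesis
    using assms unfolding bounded_operator_on_def by auto
qed

lemma bounded_operator_on_diff:
  assumes "complex_vector.subspace M" "bounded_operator_on M A" "bounded_operator_on M B"
  shows "bounded_operator_on M (\<lambda>x. A x - B x)"
proof -
  obtain K L where K: "\<And>x. x \<in> M \<Longrightarrow> norm (A x) \<le> K * norm x"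
    and L: "\<And>x. x \<in> M \<Longrightarrow> norm (B x) \<le> L * norm x"
    using assms by (meson bounded_operator_on_bound)
  have "norm (A x - B x) \<le> (K + L) * norm x" if "x \<in> M" for x
    using K[OF that] L[OF that] norm_triangle_ineq4[of "A x" "B x"] by (simp add: distrib_right)
  then show ?thesis
    using assms unfolding bounded_operator_on_def
    by (auto simp: complex_vector.subspace_diff complex_vector.scale_right_diff_distrib)
qed

lemma bounded_operator_on_scaleC:
  assumes "complex_vector.subspace M" "bounded_operator_on M A"
  shows "bounded_operator_on M (\<lambda>x. c *\<^sub>C A x)"
proof -
  obtain K where K: "\<And>x. x \<in> M \<Longrightarrow> norm (A x) \<le> K * norm x"
    using assms by (meson bounded_operator_on_bound)
  have "norm (c *\<^sub>C A x) \<le> (cmod c * K) * norm x" if "x \<in> M" for x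
    using K[OF that] by (simp add: norm_scaleC mult.assoc mult_left_mono)
  then have "\<exists>L. \<forall>x\<in>M. norm (c *\<^sub>C A x) \<le> L * norm x"
    by blast
  then show ?thesis
    using assms unfolding bounded_operator_on_def
    by (simp add: complex_vector.subspace_scale complex_vector.scale_right_distrib mult.commute)
qed

lemma self_adjoint_onI_positive:
  assumes "complex_vector.subspace M" "positive_operator_on M A"
  shows "self_adjoint_on M A"
proof -
  have A: "bounded_operator_on M A"
    using assms(2) by (simp add: positive_operator_on_def)
  have re: "Im (cinner (A x) x) = 0" if "x \<in> M" for x
    using assms(2) that by (auto simp: positive_operator_on_def complex_nonneg_Reals_iff)
  have "cinner (A x) y = cinner x (A y)" if "x \<in> M" "y \<in> M" for x y
  proof -
    \<comment> \<open>Polarization: reality of the form at \<open>x + y\<close> gives the imaginary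
      part of the symmetry, reality at \<open>x + \<i> *\<^sub>C y\<close> the real part.\<close>
    have "Im (cinner (A (x + y)) (x + y)) = 0" "Im (cinner (A (x + \<i> *\<^sub>C y)) (x + \<i> *\<^sub>C y)) = 0"
      using that assms(1) by (auto intro!: re complex_vector.subspace_add complex_vector.subspace_scale)
    then have 1: "Im (cinner (A x) y) + Im (cinner (A y) x) = 0"
      "Re (cinner (A x) y) = Re (cinner (A y) x)"
      using that assms(1) re[of x] re[of y]
      by (simp_all add: bounded_operator_on_simps[OF A assms(1)] cinner_linear
          complex_vector.subspace_scale algebra_simps)
    then have "cinner (A x) y = cnj (cinner (A y) x)"
      by (simp add: complex_eq_iff)
    then show ?thesis
      using cinner_commute[of x "A y"] by simp
  qed
  with A show ?thesis
    by (simp add: self_adjoint_on_def)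
qed

section \<open>Commutation with a positive operator\<close>

text \<open>The condition 0 \<le> B \<le> 1 in the order of quadratic forms. Self-adjointness makes
  the form real, so \<open>Re\<close> discards nothing.\<close>

definition positive_contraction_on ::
    "'a::complex_hilbert_space set \<Rightarrow> ('a \<Rightarrow> 'a) \<Rightarrow> bool"
  where "positive_contraction_on M B \<longleftrightarrow> self_adjoint_on M B \<and>
    (\<forall>x\<in>M. 0 \<le> Re (cinner (B x) x) \<and> Re (cinner (B x) x) \<le> (norm x)\<^sup>2)"

lemma norm_sq_self_adjoint_on:
  assumes "self_adjoint_on M B" "x \<in> M"
  shows "Re (cinner (B (B x)) x) = (norm (B x))\<^sup>2"
  using assms by (auto simp: self_adjoint_on_def bounded_operator_on_def cinner_self)

text \<open>Keeps the iteration in Riesz's argument among the positive contractions.\<close>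

lemma positive_contraction_on_step:
  assumes M: "complex_vector.subspace M" and B: "positive_contraction_on M B"
  shows "positive_contraction_on M (\<lambda>x. B x - B (B x))"
proof -
  have sa: "self_adjoint_on M B" and bo: "bounded_operator_on M B"
    using B by (auto simp: positive_contraction_on_def self_adjoint_on_def)
  note lin = bounded_operator_on_simps[OF bo M]
  have adj: "cinner (B x) y = cinner x (B y)" if "x \<in> M" "y \<in> M" for x y
    using sa that by (simp add: self_adjoint_on_def)
  have le: "0 \<le> Re (cinner (B x) x)" "Re (cinner (B x) x) \<le> (norm x)\<^sup>2" if "x \<in> M" for x
    using B that by (simp_all add: positive_contraction_on_def)
  have "bounded_operator_on M (\<lambda>x. B x - B (B x))"
    using bounded_operator_on_diff[OF M bo bounded_operator_on_compose[OF bo bo]] by simp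
  moreover have "0 \<le> Re (cinner (B x - B (B x)) x)"
    "Re (cinner (B x - B (B x)) x) \<le> (norm x)\<^sup>2" if x: "x \<in> M" for x
  proof -
    \<comment> \<open>\<open>B - B\<^sup>2 = B (1 - B)\<^sup>2 + B\<^sup>2 (1 - B)\<close>\<close>
    have "cinner (B x - B (B x)) x =
        cinner (B (x - B x)) (x - B x) + (cinner (B x) (B x) - cinner (B (B x)) (B x))"
      using x by (simp add: lin cinner_linear adj)
    then show "0 \<le> Re (cinner (B x - B (B x)) x)"
      using le(1)[of "x - B x"] le(2)[of "B x"] x M lin(1)[OF x]
      by (simp add: cinner_self complex_vector.subspace_diff)
    have "Re (cinner (B x - B (B x)) x) = Re (cinner (B x) x) - (norm (B x))\<^sup>2"
      using norm_sq_self_adjoint_on[OF sa x] by (simp add: cinner_linear)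
    then show "Re (cinner (B x - B (B x)) x) \<le> (norm x)\<^sup>2"
      using le(2)[OF x] zero_le_power2[of "norm (B x)"] by linarith
  qed
  ultimately show ?thesis
    using lin(1) by (auto simp: positive_contraction_on_def self_adjoint_on_def cinner_linear adj)
qed

text \<open>Nonnegativity of \<open>B - B^2\<close>, read as a norm estimate. It turns a vanishing
  form \<open>cinner (B x) x\<close> into \<open>B x = 0\<close>.\<close>

lemma positive_contraction_on_norm_le:
  assumes "complex_vector.subspace M" "positive_contraction_on M B" "x \<in> M"
  shows "(norm (B x))\<^sup>2 \<le> Re (cinner (B x) x)"
proof -
  have "0 \<le> Re (cinner (B x - B (B x)) x)"
    using positive_contraction_on_step[OF assms(1,2)] assms(3)
    by (simp add: positive_contraction_on_def)
  moreover have "Re (cinner (B (B x)) x) = (norm (B x))\<^sup>2"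
    using assms by (intro norm_sq_self_adjoint_on[of M]) (auto simp: positive_contraction_on_def)
  ultimately show ?thesis
    by (simp add: cinner_linear)
qed

text \<open>Riesz's square-root-free argument: with \<open>B\<^sub>0 = B\<close> and \<open>B\<^sub>n\<^sub>+\<^sub>1 = B\<^sub>n - B\<^sub>n\<^sup>2\<close>, the operator
  \<open>X B\<close> is the strong limit of the sums of the nonpositive operators \<open>B\<^sub>n X B\<^sub>n\<close>.\<close>

lemma commuting_nonpositive_product:
  assumes M: "complex_vector.subspace M" and B: "positive_contraction_on M B"
    and X: "bounded_operator_on M X" and Xle: "\<And>u. u \<in> M \<Longrightarrow> Re (cinner (X u) u) \<le> 0"
    and comm: "\<And>u. u \<in> M \<Longrightarrow> X (B u) = B (X u)" and x: "x \<in> M"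
  shows "Re (cinner (X (B x)) x) \<le> 0"
proof -
  define C where "C = rec_nat B (\<lambda>_ D x. D x - D (D x))"
  have C0: "C 0 = B" and CS: "C (Suc n) = (\<lambda>x. C n x - C n (C n x))" for n
    by (simp_all add: C_def)
  have pc: "positive_contraction_on M (C n)" for n
    by (induction n) (use B in \<open>auto simp: C0 CS intro: positive_contraction_on_step[OF M]\<close>)
  then have sa: "self_adjoint_on M (C n)" for n
    by (simp add: positive_contraction_on_def)
  then have bo: "bounded_operator_on M (C n)" for n
    by (simp add: self_adjoint_on_def)
  note Clin = bounded_operator_on_simps[OF bo M] and Xlin = bounded_operator_on_simps[OF X M]
  have XC: "X (C n u) = C n (X u)" if "u \<in> M" for n u
    using that by (induction n arbitrary: u) (auto simp: C0 CS comm Clin Xlin)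
  \<comment> \<open>The increment is minus the form of \<open>X\<close> at \<open>C n x\<close>,
    hence nonnegative by \<open>Xle\<close>.\<close>
  have "incseq (\<lambda>n. Re (cinner (X (C n x)) x))"
  proof (rule incseq_SucI)
    fix n
    have "cinner (C n (X (C n x))) x = cinner (X (C n x)) (C n x)"
      using sa[of n] x Clin(1) Xlin(1) by (simp add: self_adjoint_on_def)
    then show "Re (cinner (X (C n x)) x) \<le> Re (cinner (X (C (Suc n) x)) x)"
      using Xle[of "C n x"] x Clin(1) Xlin(1)
      by (simp add: CS Xlin XC cinner_linear)
  qed
  moreover have "(\<lambda>n. Re (cinner (X (C n x)) x)) \<longlonglongrightarrow> 0"
  proof -
    \<comment> \<open>The squared norms telescope: they are the drops of a decreasing sequence
      bounded below by 0, so they tend to 0.\<close>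
    define a where "a n = Re (cinner (C n x) x)" for n
    have sq: "(norm (C n x))\<^sup>2 = a n - a (Suc n)" for n
      using norm_sq_self_adjoint_on[OF sa x, of n] by (simp add: a_def CS cinner_linear)
    have "decseq a"
      by (rule decseq_SucI) (metis diff_ge_0_iff_ge sq zero_le_power2)
    moreover have "0 \<le> a n" for n
      using pc[of n] x by (simp add: a_def positive_contraction_on_def)
    ultimately obtain l where "a \<longlonglongrightarrow> l"
      using decseq_convergent[of a 0] by metis
    then have "(\<lambda>n. a n - a (Suc n)) \<longlonglongrightarrow> l - l"
      by (intro tendsto_diff) (simp_all add: filterlim_sequentially_Suc)
    then have "(\<lambda>n. sqrt ((norm (C n x))\<^sup>2)) \<longlonglongrightarrow> sqrt 0"
      unfolding sq by (intro tendsto_real_sqrt) simp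
    then have lim: "(\<lambda>n. norm (C n x)) \<longlonglongrightarrow> 0"
      by simp
    obtain K where K: "\<And>u. u \<in> M \<Longrightarrow> norm (X u) \<le> K * norm u"
      using X by (meson bounded_operator_on_bound)
    show ?thesis
    proof (rule Lim_null_comparison)
      have "norm (Re (cinner (X (C n x)) x)) \<le> K * norm (C n x) * norm x" for n
      proof -
        have "norm (Re (cinner (X (C n x)) x)) \<le> norm (X (C n x)) * norm x"
          using abs_Re_le_cmod norm_cinner_le order_trans by (metis real_norm_def)
        also have "\<dots> \<le> K * norm (C n x) * norm x"
          using K Clin(1) x by (simp add: mult_right_mono)
        finally show ?thesis .
      qed
      then show "\<forall>\<^sub>F n in sequentially. norm (Re (cinner (X (C n x)) x)) \<le> K * norm (C n x) * norm x"
        by simp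
      show "(\<lambda>n. K * norm (C n x) * norm x) \<longlonglongrightarrow> 0"
        using tendsto_mult_right[OF tendsto_mult_left[OF lim, of K], of "norm x"] by simp
    qed
  qed
  \<comment> \<open>An increasing sequence lies below its limit; its term at index 0 belongs to
    \<open>B\<close> itself.\<close>
  ultimately have "Re (cinner (X (C 0 x)) x) \<le> 0"
    by (rule incseq_le)
  then show ?thesis
    by (simp add: C0)
qed

text \<open>By Cauchy-Schwarz a norm bound for \<open>A\<close> also bounds its form, so its
  reciprocal serves as \<open>c\<close>. A positive factor changes neither kernels nor commutation
  relations.\<close>

lemma positive_operator_on_scale:
  assumes M: "complex_vector.subspace M" and A: "positive_operator_on M A"
  obtains c :: real where "c > 0" "positive_contraction_on M (\<lambda>x. complex_of_real c *\<^sub>C A x)"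
proof -
  have bo: "bounded_operator_on M A"
    using A by (simp add: positive_operator_on_def)
  then obtain K where K: "K > 0" "\<And>x. x \<in> M \<Longrightarrow> norm (A x) \<le> K * norm x"
    by (meson bounded_operator_on_bound)
  have "positive_contraction_on M (\<lambda>x. complex_of_real (1 / K) *\<^sub>C A x)"
    unfolding positive_contraction_on_def
  proof (intro conjI ballI)
    show "self_adjoint_on M (\<lambda>x. complex_of_real (1 / K) *\<^sub>C A x)"
      using bounded_operator_on_scaleC[OF M bo] self_adjoint_onI_positive[OF M A]
      by (auto simp: self_adjoint_on_def cinner_linear)
    fix x assume x: "x \<in> M"
    have "Re (cinner (A x) x) \<le> norm (A x) * norm x"
      by (rule Re_cinner_le)
    also have "\<dots> \<le> K * norm x * norm x"
      using K(2)[OF x] by (simp add: mult_right_mono)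
    finally show "Re (cinner (complex_of_real (1 / K) *\<^sub>C A x) x) \<le> (norm x)\<^sup>2"
      using K(1) by (simp add: cinner_linear field_simps power2_eq_square)
    show "0 \<le> Re (cinner (complex_of_real (1 / K) *\<^sub>C A x) x)"
      using A x K(1) by (auto simp: positive_operator_on_def cinner_linear complex_nonneg_Reals_iff)
  qed
  with K(1) show thesis
    by (intro that[of "1 / K"]) auto
qed

text \<open>\<open>K\<^sup>2 \<le> 0\<close> commutes with \<open>A\<close>, so \<open>K\<^sup>2 A \<le> 0\<close>; but \<open>K\<^sup>2 A = - K A K = K\<^sup>* A K \<ge> 0\<close>.\<close>

lemma anticommuting_positive_skew:
  assumes M: "complex_vector.subspace M" and A: "positive_operator_on M A"
    and K: "bounded_operator_on M K"
    and skew: "\<And>x y. x \<in> M \<Longrightarrow> y \<in> M \<Longrightarrow> cinner (K x) y = - cinner x (K y)"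
    and anti: "\<And>x. x \<in> M \<Longrightarrow> A (K x) = - K (A x)"
    and x: "x \<in> M"
  shows "A (K x) = 0"
proof -
  obtain c :: real where c: "c > 0" and B: "positive_contraction_on M (\<lambda>x. complex_of_real c *\<^sub>C A x)"
    using positive_operator_on_scale[OF M A] .
  let ?B = "\<lambda>x. complex_of_real c *\<^sub>C A x"
  have bo: "bounded_operator_on M A"
    using A by (simp add: positive_operator_on_def)
  note Alin = bounded_operator_on_simps[OF bo M] and Klin = bounded_operator_on_simps[OF K M]
  have "Re (cinner ((K \<circ> K) (?B x)) x) \<le> 0"
  proof (rule commuting_nonpositive_product[OF M B bounded_operator_on_compose[OF K K] _ _ x])
    show "Re (cinner ((K \<circ> K) u) u) \<le> 0" if "u \<in> M" for u
      using that by (simp add: skew Klin cinner_self)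
    show "(K \<circ> K) (?B u) = ?B ((K \<circ> K) u)" if "u \<in> M" for u
      using that by (simp add: Alin Klin anti)
  qed
  moreover have "(K \<circ> K) (?B x) = - K (?B (K x))"
    using x anti[OF x] M by (simp add: Alin Klin complex_vector.subspace_scale)
  \<comment> \<open>Skewness moves the outer \<open>K\<close> to the other argument. The resulting
    form dominates the squared norm of \<open>?B (K x)\<close>, which must therefore vanish.\<close>
  ultimately have "Re (cinner (?B (K x)) (K x)) \<le> 0"
    using skew[of "?B (K x)" x] x M
    by (simp add: cinner_minus_left Alin Klin complex_vector.subspace_scale)
  then have "norm (?B (K x)) = 0"
    using positive_contraction_on_norm_le[OF M B, of "K x"] Klin(1)[OF x]
    by (metis order_trans power2_less_eq_zero_iff norm_eq_zero)
  then show ?thesis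
    using c by (simp add: norm_scaleC)
qed

text \<open>For \<open>K = A B - B A\<close> one has \<open>A K + K A = A\<^sup>2 B - B A\<^sup>2 = 0\<close>.\<close>

lemma injective_positive_commute_square:
  assumes M: "complex_vector.subspace M" and A: "positive_operator_on M A"
    and inj: "\<And>x. x \<in> M \<Longrightarrow> A x = 0 \<Longrightarrow> x = 0"
    and B: "self_adjoint_on M B"
    and comm: "\<And>x. x \<in> M \<Longrightarrow> A (A (B x)) = B (A (A x))" and x: "x \<in> M"
  shows "A (B x) = B (A x)"
proof -
  have bA: "bounded_operator_on M A" and bB: "bounded_operator_on M B"
    using A B by (auto simp: positive_operator_on_def self_adjoint_on_def)
  note Alin = bounded_operator_on_simps[OF bA M] and Blin = bounded_operator_on_simps[OF bB M]
  have adj: "cinner (A x) y = cinner x (A y)" "cinner (B x) y = cinner x (B y)"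
    if "x \<in> M" "y \<in> M" for x y
    using self_adjoint_onI_positive[OF M A] B that by (auto simp: self_adjoint_on_def)
  have "bounded_operator_on M (\<lambda>x. A (B x) - B (A x))"
    using bounded_operator_on_diff[OF M bounded_operator_on_compose[OF bA bB]
        bounded_operator_on_compose[OF bB bA]] by simp
  then have K: "A (A (B x) - B (A x)) = 0"
  proof (rule anticommuting_positive_skew[OF M A _ _ _ x])
    \<comment> \<open>A commutator of self-adjoint operators is skew.\<close>
    show "cinner (A (B x) - B (A x)) y = - cinner x (A (B y) - B (A y))" if "x \<in> M" "y \<in> M" for x y
      using that by (simp add: Alin Blin cinner_linear adj)
    show "A (A (B x) - B (A x)) = - (A (B (A x)) - B (A (A x)))" if "x \<in> M" for x
      using that comm by (simp add: Alin Blin)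
  qed
  have "A (B x) - B (A x) \<in> M"
    using x by (intro complex_vector.subspace_diff[OF M] Alin Blin)
  then have "A (B x) - B (A x) = 0"
    using K by (rule inj)
  then show ?thesis
    by simp
qed

section \<open>Orthonormal expansions\<close>

lemma cinner_sum_right: "cinner y (sum f F) = (\<Sum>i\<in>F. cinner y (f i))"
  for y :: "'a::complex_hilbert_space"
  by (induction F rule: infinite_finite_induct) (auto simp: cinner_add_right)

lemma orthonormal_family_subset: "orthonormal_family I e \<Longrightarrow> J \<subseteq> I \<Longrightarrow> orthonormal_family J e"
  unfolding orthonormal_family_def by blast

lemma norm_sum_orthonormal:
  assumes "orthonormal_family F e" "finite F"
  shows "(norm (\<Sum>i\<in>F. c i *\<^sub>C e i))\<^sup>2 = (\<Sum>i\<in>F. (cmod (c i))\<^sup>2)"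
  using assms(2,1)
proof (induction F)
  case (insert j F)
  have "orthonormal_family F e"
    using insert.prems by (rule orthonormal_family_subset) blast
  moreover have "cinner (e j) (e j) = 1"
    using insert.prems by (simp add: orthonormal_family_def)
  then have "(norm (e j))\<^sup>2 = 1"
    unfolding cinner_self by (simp only: of_real_eq_1_iff)
  moreover have "cinner (e j) (e i) = 0" if "i \<in> F" for i
    using insert.prems insert.hyps that by (auto simp: orthonormal_family_def)
  then have "cinner (c j *\<^sub>C e j) (\<Sum>i\<in>F. c i *\<^sub>C e i) = 0"
    by (simp add: cinner_sum_right cinner_linear)
  ultimately show ?case
    using insert by (simp add: norm_add_sq norm_scaleC power_mult_distrib)
qed simp

lemma bessel_inequality:
  assumes "orthonormal_family F e" "finite F"
  shows "(\<Sum>i\<in>F. (cmod (cinner x (e i)))\<^sup>2) \<le> (norm x)\<^sup>2"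
proof -
  define y where "y = (\<Sum>i\<in>F. cinner x (e i) *\<^sub>C e i)"
  define s where "s = (\<Sum>i\<in>F. (cmod (cinner x (e i)))\<^sup>2)"
  have "cinner x y = complex_of_real s"
    unfolding y_def s_def cinner_sum_right of_real_sum
    by (intro sum.cong refl) (simp only: cinner_scaleC_right complex_norm_square mult.commute)
  moreover have "(norm y)\<^sup>2 = s"
    unfolding y_def s_def by (rule norm_sum_orthonormal[OF assms])
  ultimately have "(norm (x + - y))\<^sup>2 = (norm x)\<^sup>2 - s"
    unfolding norm_add_sq by (simp add: cinner_minus_right)
  then show ?thesis
    using zero_le_power2[of "norm (x + - y)"] unfolding s_def by linarith
qed

text \<open>Bessel's inequality bounds all finite sums of squared coefficients; by Pythagoras the
  net of finite partial sums is then Cauchy, for index sets of any cardinality.\<close>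

lemma orthonormal_expansion_summable:
  fixes e :: "'i \<Rightarrow> 'a::complex_hilbert_space"
  assumes e: "orthonormal_family I e"
  shows "(\<lambda>i. cinner x (e i) *\<^sub>C e i) summable_on I"
proof -
  let ?f = "\<lambda>i. cinner x (e i) *\<^sub>C e i" and ?g = "\<lambda>i. (cmod (cinner x (e i)))\<^sup>2"
  let ?\<F> = "{F. finite F \<and> F \<subseteq> I}"
  have bdd: "bdd_above (sum ?g ` ?\<F>)"
    using bessel_inequality orthonormal_family_subset[OF e] by (intro bdd_aboveI2) auto
  have "\<exists>R. eventually R (finite_subsets_at_top I) \<and>
      (\<forall>F F'. R F \<and> R F' \<longrightarrow> dist (sum ?f F) (sum ?f F') < \<epsilon>)" if "\<epsilon> > 0" for \<epsilon>
  proof -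
    \<comment> \<open>\<open>F0\<close> nearly exhausts the supremum, so the terms that a larger
      finite set adds have norm below \<open>\<epsilon> / 2\<close>.\<close>
    have "(SUP F\<in>?\<F>. sum ?g F) - (\<epsilon> / 2)\<^sup>2 < (SUP F\<in>?\<F>. sum ?g F)"
      using that by simp
    then obtain F0 where F0: "finite F0" "F0 \<subseteq> I"
      and less: "(SUP F\<in>?\<F>. sum ?g F) - (\<epsilon> / 2)\<^sup>2 < sum ?g F0"
      by (subst (asm) less_cSUP_iff[OF _ bdd]) auto
    define R where "R F \<longleftrightarrow> finite F \<and> F0 \<subseteq> F \<and> F \<subseteq> I" for F
    have near: "dist (sum ?f F) (sum ?f F0) < \<epsilon> / 2" if F: "R F" for F
    proof -
      have "sum ?f F - sum ?f F0 = sum ?f (F - F0)"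
        using F F0 by (simp add: R_def sum_diff)
      then have "(dist (sum ?f F) (sum ?f F0))\<^sup>2 = sum ?g (F - F0)"
        unfolding dist_norm using F
        by (simp add: R_def norm_sum_orthonormal orthonormal_family_subset[OF e] subset_iff)
      also have "\<dots> = sum ?g F - sum ?g F0"
        using F F0 by (simp add: R_def sum_diff)
      also have "\<dots> \<le> (SUP F\<in>?\<F>. sum ?g F) - sum ?g F0"
        using F bdd by (intro diff_right_mono cSUP_upper) (auto simp: R_def)
      also have "\<dots> < (\<epsilon> / 2)\<^sup>2"
        using less by simp
      finally show ?thesis
        by (rule power_less_imp_less_base) (use \<open>\<epsilon> > 0\<close> in simp)
    qed
    have "eventually R (finite_subsets_at_top I)"
      unfolding eventually_finite_subsets_at_top by (intro exI[of _ F0]) (simp add: F0 R_def)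
    moreover have "dist (sum ?f F) (sum ?f F') < \<epsilon>" if "R F" "R F'" for F F'
      using near[OF that(1)] near[OF that(2)] dist_triangle2[of "sum ?f F" "sum ?f F'" "sum ?f F0"]
      by linarith
    ultimately show ?thesis
      by blast
  qed
  then have "cauchy_filter (filtermap (sum ?f) (finite_subsets_at_top I))"
    by (simp add: cauchy_filter_metric_filtermap)
  then have "convergent_filter (filtermap (sum ?f) (finite_subsets_at_top I))"
    by (simp add: convergent_filter_iff_cauchy)
  then show ?thesis
    by (simp add: convergent_filter_iff filterlim_def summable_on_def has_sum_def)
qed

text \<open>\<open>y\<close> is the orthogonal projection of \<open>x\<close> onto the closed span:
  pairing with \<open>e i\<close> passes through the sum by continuity and leaves a single
  term.\<close>

lemma orthonormal_expansion:
  fixes e :: "'i \<Rightarrow> 'a::complex_hilbert_space"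
  assumes e: "orthonormal_family I e"
  obtains y where "((\<lambda>i. cinner x (e i) *\<^sub>C e i) has_sum y) I"
    and "\<And>i. i \<in> I \<Longrightarrow> cinner (x - y) (e i) = 0"
proof -
  obtain y where y: "((\<lambda>i. cinner x (e i) *\<^sub>C e i) has_sum y) I"
    using orthonormal_expansion_summable[OF e] by (auto simp: summable_on_def)
  have "cinner (x - y) (e i) = 0" if i: "i \<in> I" for i
  proof -
    have "((\<lambda>j. cinner (cinner x (e j) *\<^sub>C e j) (e i)) has_sum cinner y (e i)) I"
      by (rule has_sum_bounded_linear[OF bounded_linear_cinner_left y])
    moreover have "((\<lambda>j. cinner (cinner x (e j) *\<^sub>C e j) (e i)) has_sum cinner x (e i)) I"
      using e i by (intro has_sum_finite_neutralI[of "{i}"])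
        (auto simp: cinner_linear orthonormal_family_def)
    ultimately show ?thesis
      using has_sum_unique by (simp add: cinner_linear) blast
  qed
  with y show thesis
    by (rule that)
qed

text \<open>Zorn's lemma applies because two vectors from the union of a chain lie in a common
  member. A maximal set is total in \<open>M\<close>, since a nonzero vector orthogonal to it could
  be normalised and added.\<close>

lemma orthonormal_basis_of_extend:
  fixes X :: "'a::complex_hilbert_space set"
  assumes M: "complex_vector.subspace M" and "X \<subseteq> M" and X: "orthonormal_family X (\<lambda>b. b)"
  obtains B where "X \<subseteq> B" "orthonormal_basis_of M B"
proof -
  let ?\<A> = "{B. X \<subseteq> B \<and> B \<subseteq> M \<and> orthonormal_family B (\<lambda>b. b)}"
  have "\<exists>B\<in>?\<A>. \<forall>Y\<in>?\<A>. B \<subseteq> Y \<longrightarrow> Y = B"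
  proof (rule subset_Zorn_nonempty)
    show "?\<A> \<noteq> {}"
      using assms by blast
    show "\<Union>\<C> \<in> ?\<A>" if "\<C> \<noteq> {}" and \<C>: "subset.chain ?\<A> \<C>" for \<C>
    proof -
      have \<C>sub: "\<C> \<subseteq> ?\<A>" and total: "\<And>C D. C \<in> \<C> \<Longrightarrow> D \<in> \<C> \<Longrightarrow> C \<subseteq> D \<or> D \<subseteq> C"
        using \<C> by (simp_all add: subset_chain_def)
      have "cinner x y = (if x = y then 1 else 0)" if xy: "x \<in> \<Union>\<C>" "y \<in> \<Union>\<C>" for x y
      proof -
        obtain C D where CD: "C \<in> \<C>" "x \<in> C" "D \<in> \<C>" "y \<in> D"
          using xy by auto
        then obtain E where "E \<in> \<C>" "x \<in> E" "y \<in> E"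
          using total[of C D] by auto
        moreover from this have "orthonormal_family E (\<lambda>b. b)"
          using \<C>sub by auto
        ultimately show ?thesis
          by (simp add: orthonormal_family_def)
      qed
      then have "orthonormal_family (\<Union>\<C>) (\<lambda>b. b)"
        by (simp add: orthonormal_family_def)
      moreover have "X \<subseteq> \<Union>\<C>"
        using \<open>\<C> \<noteq> {}\<close> \<C>sub by fast
      moreover have "\<Union>\<C> \<subseteq> M"
        using \<C>sub by fast
      ultimately show ?thesis
        by simp
    qed
  qed
  then obtain B where "B \<in> ?\<A>" and max: "\<And>Y. Y \<in> ?\<A> \<Longrightarrow> B \<subseteq> Y \<Longrightarrow> Y = B"
    by meson
  then have B: "X \<subseteq> B" "B \<subseteq> M" "orthonormal_family B (\<lambda>b. b)"
    by simp_all
  have "x = 0" if x: "x \<in> M" and ort: "\<And>b. b \<in> B \<Longrightarrow> cinner x b = 0" for x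
  proof (rule ccontr)
    assume "x \<noteq> 0"
    define u where "u = complex_of_real (1 / norm x) *\<^sub>C x"
    have "norm u = 1"
      using \<open>x \<noteq> 0\<close> by (simp add: u_def norm_scaleC norm_divide)
    then have u: "cinner u u = 1"
      by (simp add: cinner_self)
    have uM: "u \<in> M"
      unfolding u_def by (rule complex_vector.subspace_scale[OF M x])
    have "cinner u b = 0" "cinner b u = 0" if "b \<in> B" for b
      using ort[OF that] cinner_commute[of b x] by (simp_all add: u_def cinner_linear)
    then have "orthonormal_family (insert u B) (\<lambda>b. b)" and "u \<notin> B"
      using u B(3) by (auto simp: orthonormal_family_def)
    then show False
      using max[of "insert u B"] B uM by auto
  qed
  with B show thesis
    by (intro that[of B]) (auto simp: orthonormal_basis_of_def)
qed

text \<open>Distinct indices give distinct vectors because 0 differs from 1, so a family of singular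
  vectors can be traded for the set that a basis requires.\<close>

lemma orthonormal_family_image:
  assumes "orthonormal_family I e"
  shows "orthonormal_family (e ` I) (\<lambda>b. b)"
proof -
  have "i = j" if "i \<in> I" "j \<in> I" "e i = e j" for i j
    using assms that unfolding orthonormal_family_def by (metis zero_neq_one)
  then have "cinner (e i) (e j) = (if e i = e j then 1 else 0)" if "i \<in> I" "j \<in> I" for i j
    using assms that unfolding orthonormal_family_def by (metis (full_types))
  then show ?thesis
    unfolding orthonormal_family_def by blast
qed

section \<open>Davis' symmetry\<close>

lemma orthogonal_projection_simps:
  assumes "orthogonal_projection P"
  shows "P (x + y) = P x + P y" "P (x - y) = P x - P y" "P (- x) = - P x" "P 0 = 0"
    "P (c *\<^sub>C x) = c *\<^sub>C P x" "P (P x) = P x"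
proof -
  have "linear P"
    using assms by (auto simp: orthogonal_projection_def bounded_clinear_def bounded_linear.linear)
  then show "P (x + y) = P x + P y" "P (x - y) = P x - P y" "P (- x) = - P x" "P 0 = 0"
    by (simp_all add: linear_add linear_diff linear_neg linear_0)
  show "P (c *\<^sub>C x) = c *\<^sub>C P x" "P (P x) = P x"
    using assms by (auto simp: orthogonal_projection_def bounded_clinear_def fun_eq_iff)
qed

lemma orthogonal_projection_adjoint:
  "orthogonal_projection P \<Longrightarrow> cinner (P x) y = cinner x (P y)"
  by (simp add: orthogonal_projection_def)

lemma bounded_operator_on_projection:
  assumes "orthogonal_projection P" "\<And>x. x \<in> M \<Longrightarrow> P x \<in> M"
  shows "bounded_operator_on M P"
proof -
  obtain K where "\<forall>x. norm (P x) \<le> norm x * K"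
    using assms(1) bounded_linear.bounded[of P]
    by (auto simp: orthogonal_projection_def bounded_clinear_def)
  then show ?thesis
    using assms by (auto simp: bounded_operator_on_def orthogonal_projection_simps mult.commute)
qed

lemma subspace_orth_complement: "complex_vector.subspace (orth_complement N)"
  by (auto simp: complex_vector.subspace_def orth_complement_def cinner_linear)

text \<open>Works with \<open>P\<close> and \<open>Q\<close> on the whole space instead of their
  restrictions; the two agree on \<open>M\<close>, and the theorem is transferred by congruence at
  the end.\<close>

locale davis_pair =
  fixes P Q V A :: "'a::complex_hilbert_space \<Rightarrow> 'a" and M :: "'a set"
  assumes P: "orthogonal_projection P" and Q: "orthogonal_projection Q"
    and M_eq: "M = davis_space P Q"
    and polar: "polar_decomposition_on M (\<lambda>x. P x + Q x - x) V A"
begin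

abbreviation S :: "'a \<Rightarrow> 'a" where "S x \<equiv> P x + Q x - x"

lemmas P_simps = orthogonal_projection_simps[OF P]
lemmas Q_simps = orthogonal_projection_simps[OF Q]
lemmas P_adj = orthogonal_projection_adjoint[OF P]
lemmas Q_adj = orthogonal_projection_adjoint[OF Q]

section \<open>Reduction of \<open>P\<close> and \<open>Q\<close> by \<open>M\<close>\<close>

lemma subspace_M: "complex_vector.subspace M"
  by (simp add: M_eq davis_space_def subspace_orth_complement)

lemma cinner_M_kernel: "x \<in> M \<Longrightarrow> S y = 0 \<Longrightarrow> cinner x y = 0"
  by (simp add: M_eq davis_space_def orth_complement_def)

lemma in_MI: "(\<And>y. S y = 0 \<Longrightarrow> cinner x y = 0) \<Longrightarrow> x \<in> M"
  by (simp add: M_eq davis_space_def orth_complement_def)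

text \<open>Idempotence leaves only \<open>P (Q y)\<close> when \<open>P\<close> is applied to
  \<open>S y\<close>. As \<open>S (Q y) = P (Q y)\<close>, the kernel of \<open>S\<close> is
  invariant under \<open>Q\<close>, and so is its complement \<open>M\<close> by self-adjointness;
  likewise for \<open>P\<close>.\<close>

lemma PQ_kernel:
  assumes "S y = 0"
  shows "P (Q y) = 0"
proof -
  have "P (S y) = 0"
    using assms by (simp add: P_simps)
  then show ?thesis
    by (simp add: P_simps)
qed

lemma QP_kernel:
  assumes "S y = 0"
  shows "Q (P y) = 0"
proof -
  have "Q (S y) = 0"
    using assms by (simp add: Q_simps)
  then show ?thesis
    by (simp add: Q_simps)
qed

lemma P_M: "x \<in> M \<Longrightarrow> P x \<in> M"
  by (rule in_MI) (simp add: P_adj cinner_M_kernel P_simps QP_kernel)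

lemma Q_M: "x \<in> M \<Longrightarrow> Q x \<in> M"
  by (rule in_MI) (simp add: Q_adj cinner_M_kernel Q_simps PQ_kernel)

text \<open>\<open>QPQ\<close> is self-adjoint and kills the kernel of \<open>S\<close>. Since
  \<open>x\<close> ranges over the whole space, this places the singular vectors of
  \<open>PQ\<close> in \<open>M\<close>.\<close>

lemma QPQ_M: "Q (P (Q x)) \<in> M"
  by (rule in_MI) (simp add: P_adj Q_adj P_simps Q_simps PQ_kernel)

lemma S_M: "x \<in> M \<Longrightarrow> S x \<in> M"
  by (simp add: subspace_M complex_vector.subspace_add complex_vector.subspace_diff P_M Q_M)

lemma S_adj: "cinner (S x) y = cinner x (S y)"
  by (simp add: cinner_linear P_adj Q_adj)

lemma S_inj:
  assumes "x \<in> M" "S x = 0"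
  shows "x = 0"
  using cinner_M_kernel[OF assms] by (simp add: cinner_self)

section \<open>Algebra of the modulus and the symmetry\<close>

lemma bounded_A: "bounded_operator_on M A" and positive_A: "positive_operator_on M A"
  and bounded_V: "bounded_operator_on M V"
  and S_V_A: "x \<in> M \<Longrightarrow> S x = V (A x)"
  and cinner_AA: "x \<in> M \<Longrightarrow> y \<in> M \<Longrightarrow> cinner (A (A x)) y = cinner (S x) (S y)"
  using polar by (auto simp: polar_decomposition_on_def modulus_on_def positive_operator_on_def)

lemmas A_simps = bounded_operator_on_simps[OF bounded_A subspace_M]
lemmas V_simps = bounded_operator_on_simps[OF bounded_V subspace_M]

lemma A_adj: "x \<in> M \<Longrightarrow> y \<in> M \<Longrightarrow> cinner (A x) y = cinner x (A y)"
  using self_adjoint_onI_positive[OF subspace_M positive_A] by (simp add: self_adjoint_on_def)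

lemma AA:
  assumes x: "x \<in> M"
  shows "A (A x) = S (S x)"
proof -
  \<comment> \<open>The modulus is given by a weak equation; testing it against the difference
    itself forces equality.\<close>
  let ?d = "A (A x) - S (S x)"
  have d: "?d \<in> M"
    using x by (intro complex_vector.subspace_diff[OF subspace_M] A_simps S_M)
  have "cinner (A (A x)) ?d = cinner (S (S x)) ?d"
    unfolding cinner_AA[OF x d] by (rule S_adj[symmetric])
  then have "cinner ?d ?d = 0"
    by (simp add: cinner_diff_left)
  then show ?thesis
    by (simp add: cinner_self)
qed

lemma A_inj:
  assumes "x \<in> M" "A x = 0"
  shows "x = 0"
proof (rule S_inj[OF assms(1)])
  show "S x = 0"
    using AA[OF assms(1)] assms S_inj[OF S_M] by (simp add: A_simps)
qed

text \<open>\<open>S\<close> has trivial kernel in \<open>M\<close>, so the initial space of the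
  partial isometry is all of \<open>M\<close>.\<close>

lemma norm_V:
  assumes "x \<in> M"
  shows "norm (V x) = norm x"
proof -
  have "{y \<in> M. S y = 0} \<subseteq> {0}"
    using S_inj by auto
  then have "x \<in> orth_complement {y \<in> M. S y = 0}"
    by (auto simp: orth_complement_def)
  then show ?thesis
    using assms polar by (auto simp: polar_decomposition_on_def)
qed

lemma cinner_V_V:
  assumes x: "x \<in> M" and y: "y \<in> M"
  shows "cinner (V x) (V y) = cinner x y"
proof -
  have re: "Re (cinner (V u) (V v)) = Re (cinner u v)" if "u \<in> M" "v \<in> M" for u v
    using norm_add_sq[of "V u" "V v"] norm_add_sq[of u v] norm_V[of "u + v"] that
    by (simp add: V_simps norm_V complex_vector.subspace_add[OF subspace_M])
  \<comment> \<open>Real parts at \<open>\<i> *\<^sub>C x\<close> supply the imaginary parts at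
    \<open>x\<close>.\<close>
  have "Re (cinner (V (\<i> *\<^sub>C x)) (V y)) = Re (cinner (\<i> *\<^sub>C x) y)"
    using x y by (intro re complex_vector.subspace_scale[OF subspace_M])
  then show ?thesis
    using x y re by (simp add: V_simps cinner_linear complex_eq_iff)
qed

lemma S_P: "S (P x) = Q (S x)" and S_Q: "S (Q x) = P (S x)"
  by (simp_all add: P_simps Q_simps)

text \<open>Using the intertwining relations twice, \<open>S^2 = A^2\<close> commutes with
  \<open>P\<close>; the commutation lemma passes this to the injective \<open>A\<close>.\<close>

lemma A_P: "x \<in> M \<Longrightarrow> A (P x) = P (A x)"
  by (rule injective_positive_commute_square[OF subspace_M positive_A A_inj])
    (auto simp only: self_adjoint_on_def bounded_operator_on_projection[OF P P_M] P_adj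
      AA P_M S_P S_Q)

lemma A_Q: "x \<in> M \<Longrightarrow> A (Q x) = Q (A x)"
  by (rule injective_positive_commute_square[OF subspace_M positive_A A_inj])
    (auto simp only: self_adjoint_on_def bounded_operator_on_projection[OF Q Q_M] Q_adj
      AA Q_M S_P S_Q)

lemma A_S: "x \<in> M \<Longrightarrow> A (S x) = S (A x)"
  by (simp add: A_simps A_P A_Q P_M Q_M complex_vector.subspace_add[OF subspace_M])

text \<open>Taking adjoints in \<open>S = V A\<close> gives \<open>S = A V^*\<close>, and
  \<open>V^* V = 1\<close>. The adjoint is avoided by testing against the difference.\<close>

lemma S_V:
  assumes x: "x \<in> M"
  shows "S (V x) = A x"
proof -
  let ?d = "S (V x) - A x"
  have d: "?d \<in> M"
    using x by (intro complex_vector.subspace_diff[OF subspace_M] A_simps V_simps S_M)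
  have "cinner (S (V x)) ?d = cinner (V x) (S ?d)"
    by (rule S_adj)
  also have "\<dots> = cinner x (A ?d)"
    using d x by (simp only: S_V_A cinner_V_V A_simps)
  also have "\<dots> = cinner (A x) ?d"
    using d x by (simp only: A_adj)
  finally have "cinner ?d ?d = 0"
    by (simp add: cinner_diff_left)
  then show ?thesis
    by (simp add: cinner_self)
qed

lemma S_cancel:
  assumes "x \<in> M" "y \<in> M" "S x = S y"
  shows "x = y"
  using S_inj[of "x - y"] assms complex_vector.subspace_diff[OF subspace_M]
  by (simp add: P_simps Q_simps algebra_simps)

text \<open>After applying \<open>S\<close>, which commutes with \<open>A\<close>, both sides equal
  \<open>A^2 = S^2\<close>.\<close>

lemma A_V:
  assumes "x \<in> M"
  shows "A (V x) = S x"
proof (rule S_cancel)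
  show "S (A (V x)) = S (S x)"
    using A_S[OF V_simps(1)[OF assms]] S_V[OF assms] AA[OF assms] by simp
qed (use assms in \<open>simp_all only: A_simps V_simps S_M\<close>)

text \<open>\<open>S V V = A V = S\<close>, and \<open>S\<close> is injective on
  \<open>M\<close>.\<close>

lemma V_V:
  assumes "x \<in> M"
  shows "V (V x) = x"
proof (rule S_cancel)
  show "S (V (V x)) = S x"
    using assms by (simp only: S_V V_simps A_V)
qed (use assms in \<open>simp_all only: V_simps\<close>)

lemma V_adj: "x \<in> M \<Longrightarrow> y \<in> M \<Longrightarrow> cinner (V x) y = cinner x (V y)"
  using cinner_V_V[of "V x" y] V_V[of x] by (simp add: V_simps)

lemma A_cancel:
  assumes "x \<in> M" "y \<in> M" "A x = A y"
  shows "x = y"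
  using A_inj[of "x - y"] assms complex_vector.subspace_diff[OF subspace_M]
  by (simp add: A_simps)

text \<open>\<open>A V P = S P = Q S = Q A V = A Q V\<close>, and \<open>A\<close> can be
  cancelled.\<close>

lemma V_P:
  assumes "x \<in> M"
  shows "V (P x) = Q (V x)"
proof (rule A_cancel)
  show "A (V (P x)) = A (Q (V x))"
    using assms by (simp only: A_V P_M A_Q V_simps S_P)
qed (use assms in \<open>simp_all only: P_M Q_M V_simps\<close>)

lemma V_Q:
  assumes "x \<in> M"
  shows "V (Q x) = P (V x)"
  using V_P[OF V_simps(1)[OF assms]] assms by (metis P_M Q_M V_V V_simps(1))

lemma QVQ_QVQ: "x \<in> M \<Longrightarrow> Q (V (Q (Q (V (Q x))))) = Q (P (Q x))"
  by (simp add: Q_simps V_Q V_P V_V Q_M V_simps P_M)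

lemma AAQ: "x \<in> M \<Longrightarrow> A (A (Q x)) = Q (P (Q x))"
  by (simp add: AA Q_M P_simps Q_simps)

text \<open>Both \<open>QVQ\<close> and \<open>AQ\<close> square to \<open>QPQ\<close>, and \<open>QVQ (QVQ - AQ) = 0\<close> because \<open>V A = P + Q - 1\<close>;
  on \<open>R(Q)\<close> the operator \<open>QVQ\<close> is injective.\<close>

lemma QVQ_eq_AQ:
  assumes x: "x \<in> M"
  shows "Q (V (Q x)) = A (Q x)"
proof -
  define d where "d = Q (V (Q x)) - A (Q x)"
  have d: "d \<in> M" and Qd: "Q d = d"
    using x by (simp_all add: d_def complex_vector.subspace_diff[OF subspace_M] Q_M A_simps
        V_simps Q_simps A_Q[symmetric])
  have "Q (V (A (Q x))) = Q (P (Q x))"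
    using S_V_A[OF Q_M[OF x]] by (simp add: Q_simps)
  then have "Q (V d) = 0"
    using x QVQ_QVQ[OF x] by (simp add: d_def V_simps Q_M A_simps Q_simps)
  \<comment> \<open>Another application of \<open>Q V\<close> turns \<open>Q (V d) = 0\<close> into
    \<open>Q (P (Q d)) = 0\<close>, which is the claim because \<open>Q d = d\<close>.\<close>
  then have "A (A d) = 0"
    using QVQ_QVQ[OF d] AAQ[OF d] by (simp add: Qd Q_simps V_simps)
  then have "d = 0"
    using A_inj d by (metis A_simps(1))
  then show ?thesis
    by (simp add: d_def)
qed

lemma self_adjoint_QVQ: "self_adjoint_on M (Q \<circ> V \<circ> Q)"
  unfolding self_adjoint_on_def
  using bounded_operator_on_projection[OF Q Q_M] bounded_V
  by (auto intro!: bounded_operator_on_compose simp: Q_adj V_adj Q_M V_simps)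

lemma self_adjoint_PVP: "self_adjoint_on M (P \<circ> V \<circ> P)"
  unfolding self_adjoint_on_def
  using bounded_operator_on_projection[OF P P_M] bounded_V
  by (auto intro!: bounded_operator_on_compose simp: P_adj V_adj P_M V_simps)

end

section \<open>Extensionality and dependence on the values on \<open>M\<close>\<close>

lemma cinner_ext: "(\<And>y. cinner u y = cinner v y) \<Longrightarrow> u = v" for u :: "'a::complex_hilbert_space"
proof -
  assume "\<And>y. cinner u y = cinner v y"
  then have "cinner (u - v) (u - v) = 0"
    by (simp add: cinner_diff_left)
  then show "u = v"
    by (simp add: cinner_self)
qed

lemma self_adjoint_on_cong:
  assumes M: "complex_vector.subspace M" and eq: "\<And>x. x \<in> M \<Longrightarrow> A x = B x"
  shows "self_adjoint_on M A \<longleftrightarrow> self_adjoint_on M B"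
  using complex_vector.subspace_add[OF M] complex_vector.subspace_scale[OF M]
  by (simp add: self_adjoint_on_def bounded_operator_on_def eq)

lemma diagonalizable_on_cong:
  assumes M: "complex_vector.subspace M" and eq: "\<And>x. x \<in> M \<Longrightarrow> A x = B x"
  shows "diagonalizable_on M A \<longleftrightarrow> diagonalizable_on M B"
proof -
  have "eigenvector_on M A b \<longleftrightarrow> eigenvector_on M B b" for b
    by (auto simp: eigenvector_on_def eq)
  then show ?thesis
    using self_adjoint_on_cong[OF M eq] by (simp add: diagonalizable_on_def)
qed

lemma polar_decomposition_on_cong:
  assumes "\<And>x. x \<in> M \<Longrightarrow> S x = S' x" "polar_decomposition_on M S V A"
  shows "polar_decomposition_on M S' V A"
proof -
  have "{y \<in> M. S y = 0} = {y \<in> M. S' y = 0}"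
    using assms(1) by auto
  then show ?thesis
    using assms by (simp add: polar_decomposition_on_def modulus_on_def)
qed

section \<open>Singular vectors of the product\<close>

context davis_pair
begin

lemma bounded_linear_PQ: "bounded_linear (\<lambda>x. P (Q x))"
  using P Q bounded_linear_compose[of P Q]
  by (simp add: orthogonal_projection_def bounded_clinear_def)

lemma cinner_PQ_PQ: "cinner (P (Q x)) (P (Q y)) = cinner (Q (P (Q x))) y"
  by (simp add: P_adj Q_adj P_simps)

text \<open>The squared norm of \<open>P (Q x)\<close> is the form of \<open>QPQ\<close> at
  \<open>x\<close>.\<close>

lemma PQ_eq_0_iff: "P (Q x) = 0 \<longleftrightarrow> Q (P (Q x)) = 0"
proof
  assume "Q (P (Q x)) = 0"
  then have "cinner (P (Q x)) (P (Q x)) = 0"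
    by (simp add: cinner_PQ_PQ)
  then show "P (Q x) = 0"
    by (simp add: cinner_self)
qed (simp add: Q_simps)

lemma QPQ_eigen:
  assumes "b \<in> M" "Q (V (Q b)) = c *\<^sub>C b"
  shows "Q (P (Q b)) = (c * c) *\<^sub>C b"
proof -
  have "Q (P (Q b)) = Q (V (Q (c *\<^sub>C b)))"
    using QVQ_QVQ[OF assms(1)] assms(2) by simp
  then show ?thesis
    using assms by (simp add: Q_simps V_simps Q_M)
qed

text \<open>The singular values are the nonzero norms of \<open>P (Q b)\<close>, and the normalised
  images are the left singular vectors. They are orthogonal because each \<open>b\<close> is an
  eigenvector of \<open>QPQ\<close>.\<close>

lemma S_decomposable_if_eigenbasis:
  assumes B: "orthonormal_basis_of M B" and eigen: "\<forall>b\<in>B. eigenvector_on M (Q \<circ> V \<circ> Q) b"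
  shows "S_decomposable (P \<circ> Q)"
proof -
  have BM: "B \<subseteq> M" and ortho: "orthonormal_family B (\<lambda>b. b)"
    and total: "\<And>x. x \<in> M \<Longrightarrow> (\<And>b. b \<in> B \<Longrightarrow> cinner x b = 0) \<Longrightarrow> x = 0"
    using B by (auto simp: orthonormal_basis_of_def)
  have QPQ: "\<exists>k. Q (P (Q b)) = k *\<^sub>C b" if "b \<in> B" for b
    using eigen that BM QPQ_eigen by (fastforce simp: eigenvector_on_def)
  define I where "I = {b \<in> B. P (Q b) \<noteq> 0}"
  define s where "s b = norm (P (Q b))" for b
  define \<psi> where "\<psi> b = complex_of_real (1 / s b) *\<^sub>C P (Q b)" for b
  have orthoI: "orthonormal_family I (\<lambda>b. b)"
    using ortho by (rule orthonormal_family_subset) (auto simp: I_def)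
  have pos: "s b > 0" if "b \<in> I" for b
    using that by (simp add: I_def s_def)
  have "cinner (\<psi> b) (\<psi> b') = (if b = b' then 1 else 0)" if b: "b \<in> I" "b' \<in> I" for b b'
  proof (cases "b = b'")
    case True
    have "norm (\<psi> b) = 1"
      using pos[OF b(1)] by (simp add: \<psi>_def norm_scaleC norm_divide) (simp add: s_def)
    then show ?thesis
      using True by (simp add: cinner_self)
  next
    case False
    obtain k where "Q (P (Q b)) = k *\<^sub>C b"
      using QPQ b by (auto simp: I_def)
    then have "cinner (P (Q b)) (P (Q b')) = k * cinner b b'"
      by (simp add: cinner_PQ_PQ cinner_linear)
    also have "cinner b b' = 0"
      using False b orthoI by (simp add: orthonormal_family_def)
    finally show ?thesis
      using False by (simp add: \<psi>_def cinner_linear)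
  qed
  then have ortho\<psi>: "orthonormal_family I \<psi>"
    by (simp add: orthonormal_family_def)
  have "((\<lambda>b. (complex_of_real (s b) * cinner x b) *\<^sub>C \<psi> b) has_sum P (Q x)) I" for x
  proof -
    obtain y where y: "((\<lambda>b. cinner x b *\<^sub>C b) has_sum y) B"
      and ort: "\<And>b. b \<in> B \<Longrightarrow> cinner (x - y) b = 0"
      using orthonormal_expansion[OF ortho] by metis
    \<comment> \<open>Here \<open>x\<close> need not lie in \<open>M\<close>, but \<open>QPQ\<close>
      maps into \<open>M\<close>, where orthogonality to the eigenbasis suffices.\<close>
    have "Q (P (Q (x - y))) = 0"
    proof (rule total[OF QPQ_M])
      fix b assume "b \<in> B"
      moreover from this obtain k where "Q (P (Q b)) = k *\<^sub>C b"
        using QPQ by blast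
      moreover have "cinner (Q (P (Q (x - y)))) b = cinner (x - y) (Q (P (Q b)))"
        by (simp only: P_adj Q_adj)
      ultimately show "cinner (Q (P (Q (x - y)))) b = 0"
        using ort by (simp only: cinner_scaleC_right mult_zero_right)
    qed
    then have "P (Q (x - y)) = 0"
      by (simp only: PQ_eq_0_iff)
    then have eq: "P (Q y) = P (Q x)"
      by (simp add: P_simps Q_simps)
    have "((\<lambda>b. P (Q (cinner x b *\<^sub>C b))) has_sum P (Q x)) B"
      using has_sum_bounded_linear[OF bounded_linear_PQ y] unfolding eq .
    \<comment> \<open>Basis vectors killed by \<open>PQ\<close> contribute zero terms, so
      \<open>B\<close> may be cut down to \<open>I\<close>.\<close>
    also have "?this \<longleftrightarrow> ?thesis"
    proof (rule has_sum_cong_neutral)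
      fix b assume "b \<in> B \<inter> I"
      then have "complex_of_real (s b) \<noteq> 0"
        using pos[of b] by simp
      then show "P (Q (cinner x b *\<^sub>C b)) = (complex_of_real (s b) * cinner x b) *\<^sub>C \<psi> b"
        by (simp add: \<psi>_def P_simps Q_simps)
    qed (auto simp: I_def P_simps Q_simps)
    finally show ?thesis .
  qed
  moreover have "bounded_clinear (P \<circ> Q)"
    using bounded_linear_PQ by (simp add: bounded_clinear_def o_def P_simps Q_simps)
  ultimately show ?thesis
    unfolding S_decomposable_def comp_apply using orthoI ortho\<psi> pos by blast
qed

text \<open>On \<open>x\<close> one has \<open>A^2 = s^2\<close>, so \<open>d = (A - s) x\<close>
  satisfies \<open>A d = - s d\<close>; positivity of \<open>A\<close> then forces
  \<open>d = 0\<close>.\<close>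

lemma singular_vector_eigen:
  assumes x: "Q (P (Q x)) = complex_of_real (s\<^sup>2) *\<^sub>C x" and s: "s > 0"
  shows "x \<in> M" "Q (V (Q x)) = complex_of_real s *\<^sub>C x"
proof -
  have x_eq: "x = complex_of_real (1 / s\<^sup>2) *\<^sub>C Q (P (Q x))"
    using s by (simp add: x)
  show xM: "x \<in> M"
    by (subst x_eq) (intro complex_vector.subspace_scale[OF subspace_M] QPQ_M)
  have Qx: "Q x = x"
    by (subst (1 2) x_eq) (simp add: Q_simps)
  define d where "d = A x - complex_of_real s *\<^sub>C x"
  have d: "d \<in> M"
    unfolding d_def using xM
    by (intro complex_vector.subspace_diff[OF subspace_M] complex_vector.subspace_scale[OF subspace_M]
        A_simps)
  have "A (A x) = complex_of_real (s\<^sup>2) *\<^sub>C x"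
    using AAQ[OF xM] x by (simp add: Qx)
  then have "A d = - complex_of_real s *\<^sub>C d"
    using xM by (simp add: d_def A_simps complex_vector.subspace_scale[OF subspace_M]
        complex_vector.scale_right_diff_distrib power2_eq_square)
  then have "Re (cinner (A d) d) = - s * (norm d)\<^sup>2"
    by (simp add: cinner_linear cinner_self)
  moreover have "Re (cinner (A d) d) \<ge> 0"
    using positive_A d by (auto simp: positive_operator_on_def complex_nonneg_Reals_iff)
  ultimately have "s * (norm d)\<^sup>2 \<le> 0"
    by simp
  then have "d = 0"
    using s by (simp add: mult_le_0_iff)
  then show "Q (V (Q x)) = complex_of_real s *\<^sub>C x"
    unfolding QVQ_eq_AQ[OF xM] by (simp add: Qx d_def)
qed

text \<open>The right singular vectors are eigenvectors of \<open>QPQ\<close>, hence of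
  \<open>QVQ\<close>. The vectors that complete them to a basis of \<open>M\<close> get eigenvalue
  0.\<close>

lemma eigenbasis_if_S_decomposable:
  assumes "S_decomposable (P \<circ> Q)"
  obtains B where "orthonormal_basis_of M B" "\<forall>b\<in>B. eigenvector_on M (Q \<circ> V \<circ> Q) b"
proof -
  obtain I :: "'a set" and s :: "'a \<Rightarrow> real" and \<xi> \<psi>
    where \<xi>: "orthonormal_family I \<xi>" and \<psi>: "orthonormal_family I \<psi>" and s: "\<forall>i\<in>I. s i > 0"
      and sum: "\<And>x. ((\<lambda>i. (complex_of_real (s i) * cinner x (\<xi> i)) *\<^sub>C \<psi> i) has_sum P (Q x)) I"
    using assms unfolding S_decomposable_def comp_apply by blast
  have PQ\<xi>: "P (Q (\<xi> i)) = complex_of_real (s i) *\<^sub>C \<psi> i" if i: "i \<in> I" for i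
  proof (rule has_sum_unique[OF sum])
    show "((\<lambda>j. (complex_of_real (s j) * cinner (\<xi> i) (\<xi> j)) *\<^sub>C \<psi> j) has_sum
        complex_of_real (s i) *\<^sub>C \<psi> i) I"
      using \<xi> i by (intro has_sum_finite_neutralI[of "{i}"]) (auto simp: orthonormal_family_def)
  qed
  \<comment> \<open>The weak form of \<open>T^* \<psi> = s \<xi>\<close> for \<open>T = PQ\<close>;
    pairing with \<open>\<psi> i\<close> isolates one term of the series.\<close>
  have PQ\<psi>: "cinner (P (Q x)) (\<psi> i) = complex_of_real (s i) * cinner x (\<xi> i)" if i: "i \<in> I" for x i
  proof (rule has_sum_unique[OF has_sum_bounded_linear[OF bounded_linear_cinner_left sum]])
    show "((\<lambda>j. cinner ((complex_of_real (s j) * cinner x (\<xi> j)) *\<^sub>C \<psi> j) (\<psi> i)) has_sum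
        complex_of_real (s i) * cinner x (\<xi> i)) I"
      using \<psi> i by (intro has_sum_finite_neutralI[of "{i}"])
        (auto simp: orthonormal_family_def cinner_linear)
  qed
  have "Q (P (Q (\<xi> i))) = complex_of_real ((s i)\<^sup>2) *\<^sub>C \<xi> i" if i: "i \<in> I" for i
  proof (rule cinner_ext)
    fix x
    have "cinner (Q (P (Q (\<xi> i)))) x = complex_of_real (s i) * cinner (\<psi> i) (P (Q x))"
      unfolding cinner_PQ_PQ[symmetric] by (simp add: PQ\<xi>[OF i] cinner_linear)
    also have "cinner (\<psi> i) (P (Q x)) = complex_of_real (s i) * cinner (\<xi> i) x"
      by (subst (1 2) cinner_commute) (simp add: PQ\<psi>[OF i])
    finally show "cinner (Q (P (Q (\<xi> i)))) x = cinner (complex_of_real ((s i)\<^sup>2) *\<^sub>C \<xi> i) x"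
      by (simp add: cinner_linear power2_eq_square)
  qed
  then have \<xi>M: "\<xi> i \<in> M" and \<xi>_eigen: "Q (V (Q (\<xi> i))) = complex_of_real (s i) *\<^sub>C \<xi> i"
    if "i \<in> I" for i
    using singular_vector_eigen s that by blast+
  obtain B where XB: "\<xi> ` I \<subseteq> B" and B: "orthonormal_basis_of M B"
    using orthonormal_basis_of_extend[OF subspace_M _ orthonormal_family_image[OF \<xi>]] \<xi>M by blast
  have ortho: "cinner b b' = (if b = b' then 1 else 0)" if "b \<in> B" "b' \<in> B" for b b'
    using B that by (simp add: orthonormal_basis_of_def orthonormal_family_def)
  have "eigenvector_on M (Q \<circ> V \<circ> Q) b" if b: "b \<in> B" for b
  proof -
    have bM: "b \<in> M"
      using B b by (auto simp: orthonormal_basis_of_def)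
    have "\<exists>c. Q (V (Q b)) = c *\<^sub>C b"
    proof (cases "b \<in> \<xi> ` I")
      case True
      then show ?thesis
        using \<xi>_eigen by blast
    next
      case False
      \<comment> \<open>An added basis vector is orthogonal to every \<open>\<xi> i\<close>, so all
        terms of the series for \<open>P (Q b)\<close> vanish.\<close>
      then have "cinner b (\<xi> i) = 0" if "i \<in> I" for i
        using ortho[OF b, of "\<xi> i"] XB that by (metis imageI subsetD)
      then have "((\<lambda>i. (complex_of_real (s i) * cinner b (\<xi> i)) *\<^sub>C \<psi> i) has_sum 0) I"
        by (intro has_sum_0) simp
      then have "P (Q b) = 0"
        using has_sum_unique[OF sum] by blast
      then have "A (A (Q b)) = 0"
        using AAQ[OF bM] by (simp add: Q_simps)
      then have "A (Q b) = 0"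
        using A_inj bM by (simp add: A_simps Q_M)
      then have "Q (V (Q b)) = 0 *\<^sub>C b"
        using QVQ_eq_AQ[OF bM] by simp
      then show ?thesis ..
    qed
    then show ?thesis
      using bM ortho[OF b b] by (auto simp: eigenvector_on_def)
  qed
  with B show thesis
    by (intro that) auto
qed

lemma S_decomposable_iff_diagonalizable:
  "S_decomposable (P \<circ> Q) \<longleftrightarrow> diagonalizable_on M (Q \<circ> V \<circ> Q)"
  using S_decomposable_if_eigenbasis eigenbasis_if_S_decomposable self_adjoint_QVQ
  unfolding diagonalizable_on_def by metis

section \<open>From \<open>QVQ\<close> to \<open>PVP\<close> by the unitary \<open>V\<close>\<close>

lemma orthonormal_basis_of_V_image:
  assumes B: "orthonormal_basis_of M B"
  shows "orthonormal_basis_of M (V ` B)"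
proof -
  have BM: "B \<subseteq> M"
    using B by (simp add: orthonormal_basis_of_def)
  have "cinner (V b) (V b') = (if b = b' then 1 else 0)" if "b \<in> B" "b' \<in> B" for b b'
    using B BM that by (auto simp: orthonormal_basis_of_def orthonormal_family_def cinner_V_V subset_iff)
  then have "orthonormal_family (V ` B) (\<lambda>b. b)"
    by (intro orthonormal_family_image) (simp add: orthonormal_family_def)
  moreover have "x = 0" if x: "x \<in> M" and ort: "\<forall>b\<in>V ` B. cinner x b = 0" for x
  proof -
    have "cinner (V x) b = 0" if "b \<in> B" for b
      using V_adj[OF x, of b] ort BM that by auto
    then have "V x = 0"
      using B V_simps(1)[OF x] by (auto simp: orthonormal_basis_of_def)
    then show ?thesis
      using norm_V[OF x] by simp
  qed
  ultimately show ?thesis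
    using BM V_simps(1) by (auto simp: orthonormal_basis_of_def)
qed

lemma eigenvector_on_V_image:
  assumes X: "\<And>x. x \<in> M \<Longrightarrow> X x \<in> M" and Y: "\<And>x. x \<in> M \<Longrightarrow> Y (V x) = V (X x)"
    and b: "eigenvector_on M X b"
  shows "eigenvector_on M Y (V b)"
  using b norm_V[of b] by (auto simp: eigenvector_on_def Y V_simps)

text \<open>On \<open>M\<close>, both \<open>PVP V\<close> and \<open>V QVQ\<close> equal
  \<open>PQ\<close>, and both \<open>QVQ V\<close> and \<open>V PVP\<close> equal \<open>QP\<close>;
  so \<open>V\<close> carries one eigenbasis to the other.\<close>

lemma diagonalizable_QVQ_iff_PVP:
  "diagonalizable_on M (Q \<circ> V \<circ> Q) \<longleftrightarrow> diagonalizable_on M (P \<circ> V \<circ> P)"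
proof
  have "(P \<circ> V \<circ> P) (V x) = V ((Q \<circ> V \<circ> Q) x)" if "x \<in> M" for x
    using that by (simp add: V_Q V_P V_V V_simps P_M Q_M)
  then have "eigenvector_on M (P \<circ> V \<circ> P) (V b)" if "eigenvector_on M (Q \<circ> V \<circ> Q) b" for b
    using that by (rule eigenvector_on_V_image[rotated]) (simp_all add: V_simps Q_M)
  then show "diagonalizable_on M (Q \<circ> V \<circ> Q) \<Longrightarrow> diagonalizable_on M (P \<circ> V \<circ> P)"
    unfolding diagonalizable_on_def using self_adjoint_PVP orthonormal_basis_of_V_image by blast
  have "(Q \<circ> V \<circ> Q) (V x) = V ((P \<circ> V \<circ> P) x)" if "x \<in> M" for x
    using that by (simp add: V_Q V_P V_V V_simps P_M Q_M)
  then have "eigenvector_on M (Q \<circ> V \<circ> Q) (V b)" if "eigenvector_on M (P \<circ> V \<circ> P) b" for b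
    using that by (rule eigenvector_on_V_image[rotated]) (simp_all add: V_simps P_M)
  then show "diagonalizable_on M (P \<circ> V \<circ> P) \<Longrightarrow> diagonalizable_on M (Q \<circ> V \<circ> Q)"
    unfolding diagonalizable_on_def using self_adjoint_QVQ orthonormal_basis_of_V_image by blast
qed

text \<open>As \<open>Q\<close> fixes \<open>x\<close> and \<open>y\<close>, the inner product of
  \<open>V x\<close> and \<open>y\<close> equals that of \<open>Q (V (Q x))\<close> and
  \<open>y\<close>, a multiple of \<open>cinner x y\<close>.\<close>

lemma cinner_V_eigenvectors:
  assumes x: "eigenvector_on (Q ` M) (Q \<circ> V \<circ> Q) x" and y: "y \<in> Q ` M" and "cinner x y = 0"
  shows "cinner (V x) y = 0"
proof -
  have "Q x = x" "Q y = y"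
    using x y by (auto simp: eigenvector_on_def Q_simps)
  moreover obtain c where "Q (V (Q x)) = c *\<^sub>C x"
    using x by (auto simp: eigenvector_on_def)
  ultimately have "Q (V x) = c *\<^sub>C x" and "cinner (Q (V x)) y = cinner (V x) y"
    using Q_adj[of "V x" y] by simp_all
  then show ?thesis
    using assms(3) by (simp add: cinner_scaleC_left)
qed

end

theorem proposition6p1:
  fixes P Q P' Q' V :: "'a::complex_hilbert_space \<Rightarrow> 'a" and H' :: "'a set"
  assumes "orthogonal_projection P" and "orthogonal_projection Q"
    and "H' = davis_space P Q"
    and "P' = restrict P H'" and "Q' = restrict Q H'"
    and "davis_symmetry H' P' Q' V"
  shows "(S_decomposable (P \<circ> Q) \<longleftrightarrow> diagonalizable_on H' (Q' \<circ> V \<circ> Q')) \<and>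
    (diagonalizable_on H' (Q' \<circ> V \<circ> Q') \<longleftrightarrow> diagonalizable_on H' (P' \<circ> V \<circ> P')) \<and>
    (\<forall>(I :: 'i set) \<xi>. orthonormal_eigensystem_in_range I \<xi> H' Q' V \<longrightarrow>
      (\<forall>n\<in>I. \<forall>k\<in>I. n \<noteq> k \<longrightarrow> cinner (V (\<xi> n)) (\<xi> k) = 0))"
proof -
  have P': "P' x = P x" and Q': "Q' x = Q x" if "x \<in> H'" for x
    using that assms by simp_all
  obtain A where "polar_decomposition_on H' (\<lambda>x. P' x + Q' x - x) V A"
    using assms(6) by (auto simp: davis_symmetry_def)
  then have "polar_decomposition_on H' (\<lambda>x. P x + Q x - x) V A"
    by (rule polar_decomposition_on_cong[rotated]) (simp add: P' Q')
  then interpret davis_pair P Q V A H'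
    using assms(1-3) by unfold_locales
  \<comment> \<open>Restrictions are unspecified outside \<open>H'\<close>, but every intermediate
    vector stays in \<open>H'\<close>.\<close>
  have QVQ: "(Q' \<circ> V \<circ> Q') x = (Q \<circ> V \<circ> Q) x" and PVP: "(P' \<circ> V \<circ> P') x = (P \<circ> V \<circ> P) x"
    if "x \<in> H'" for x
    using that by (simp_all add: P' Q' P_M Q_M V_simps)
  have QVQ_cong: "diagonalizable_on H' (Q' \<circ> V \<circ> Q') \<longleftrightarrow> diagonalizable_on H' (Q \<circ> V \<circ> Q)"
    by (rule diagonalizable_on_cong[OF subspace_M]) (rule QVQ)
  have PVP_cong: "diagonalizable_on H' (P' \<circ> V \<circ> P') \<longleftrightarrow> diagonalizable_on H' (P \<circ> V \<circ> P)"
    by (rule diagonalizable_on_cong[OF subspace_M]) (rule PVP)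
  show ?thesis
  proof (intro conjI allI impI ballI)
    show "S_decomposable (P \<circ> Q) \<longleftrightarrow> diagonalizable_on H' (Q' \<circ> V \<circ> Q')"
      unfolding QVQ_cong by (rule S_decomposable_iff_diagonalizable)
    show "diagonalizable_on H' (Q' \<circ> V \<circ> Q') \<longleftrightarrow> diagonalizable_on H' (P' \<circ> V \<circ> P')"
      unfolding QVQ_cong PVP_cong by (rule diagonalizable_QVQ_iff_PVP)
    fix I :: "'i set" and \<xi> n k
    assume \<xi>: "orthonormal_eigensystem_in_range I \<xi> H' Q' V" and nk: "n \<in> I" "k \<in> I" "n \<noteq> k"
    show "cinner (V (\<xi> n)) (\<xi> k) = 0"
    proof (rule cinner_V_eigenvectors)
      have image: "Q' ` H' = Q ` H'"
        using Q' by (rule image_cong[OF refl])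
      have ev: "eigenvector_on (Q' ` H') (Q' \<circ> V \<circ> Q') (\<xi> n)" "\<xi> k \<in> Q' ` H'"
        using \<xi> nk by (auto simp: orthonormal_eigensystem_in_range_def eigenvector_on_def)
      then show "\<xi> k \<in> Q ` H'"
        by (simp only: image)
      \<comment> \<open>\<open>QVQ\<close> is available on \<open>H'\<close> only, so the
        eigenvector is first placed there.\<close>
      have "\<xi> n \<in> H'"
        using ev(1) Q_M by (auto simp: eigenvector_on_def image)
      then show "eigenvector_on (Q ` H') (Q \<circ> V \<circ> Q) (\<xi> n)"
        using ev(1) QVQ by (auto simp: eigenvector_on_def image)
      show "cinner (\<xi> n) (\<xi> k) = 0"
        using \<xi> nk by (simp add: orthonormal_eigensystem_in_range_def orthonormal_family_def)
    qed
  qed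
qed

end
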